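(* Let $L=(L,\leq,(\sqsubseteq_\alpha)_{\alpha<\kappa})$ be a model. For each $\alpha<\kappa$ let $L|_\alpha=\{x|_\alpha : x\in L\}$, ordered by the restriction of $\leq$, and for $\beta<\alpha<\kappa$ define $h^\alpha_\beta: L|_\alpha\to L|_\beta$ by $h^\alpha_\beta(x)=x|_\beta$. Then each $L|_\alpha$ is a complete lattice, the maps $h^\alpha_\beta$ are locally completely additive projections forming an inverse system, and $L$ is isomorphic (as a stratified complete lattice) to the stratified complete lattice determined by the limit of this inverse system.
   Context: Fix a limit ordinal $\kappa$. A stratified complete lattice is $(L,\leq,(\sqsubseteq_\alpha)_{\alpha<\kappa})$ where $(L,\leq)$ is a complete lattice and each $\sqsubseteq_\alpha$ is a preorder on $L$; $x=_\alpha y$ means $x\sqsubseteq_\alpha y$ and $y\sqsubseteq_\alpha x$. Axioms: (A1) for $\alpha<\beta<\kappa$, $x\sqsubseteq_\beta y$ implies $x=_\alpha y$; (A2) if $x=_\alpha y$ for all $\alpha<\kappa$ then $x=y$; (A3) for all $x$ and $\alpha<\kappa$ there is $y$ with $x=_\alpha y$ such that for all $z$, $x\sqsubseteq_\alpha z$ implies $y\leq z$ (this $y$ is unique and is denoted $x|_\alpha$); (A4) for all $\alpha<\kappa$, nonempty $I$, and $x_i,y$ with $x_i=_\alpha y$ for all $i\in I$, $\bigvee_{i\in I}x_i=_\alpha y$; (A5) $x\leq y$ implies $x|_\alpha\leq y|_\alpha$; (A6) if $x\leq y$ and $x=_\beta y$ for all $\beta<\alpha$, then $x\sqsubseteq_\alpha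 y$. A model is a stratified complete lattice satisfying A1–A6. An isomorphism of stratified complete lattices is a bijection $f$ with $x\leq y\iff f(x)\leq f(y)$ and $x\sqsubseteq_\alpha y\iff f(x)\sqsubseteq_\alpha f(y)$ for all $\alpha$. For complete lattices $L,L'$, a monotone map $h:L'\to L$ is a projection if there is a monotone $k:L\to L'$ with $h\circ k=\mathrm{id}_L$ and $k(h(y))\leq y$ for all $y\in L'$; $h$ is locally completely additive if for every nonempty $Y\subseteq L'$ and $x\in L$ with $h(y)=x$ for all $y\in Y$, one has $h(\bigvee Y)=x$. An inverse system consists of complete lattices $L_\alpha$ ($\alpha<\kappa$) and projections $h^\alpha_\beta:L_\alpha\to L_\beta$ ($\beta<\alpha<\kappa$) with $h^\beta_\gamma\circ h^\alpha_\beta=h^\alpha_\gamma$ for $\gamma<\beta<\alpha$. Its limit $L_\infty$ is the set of sequences $(x_\alpha)_{\alpha<\kappa}\in\prod_\alpha L_\alpha$ with $h^\alpha_\beta(x_\alpha)=x_\beta$ for all $\beta<\alpha$, ordered pointwise (a complete lattice). The stratified complete lattice determined by the limit is $L_\infty$ with $x\sqsubseteq_\alpha y$ iff $x_\alpha\leq y_\alpha$ and $x_\beta=y_\beta$ for all $\beta<\alpha$. *)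

theory Defs
  imports "HOL-Algebra.Complete_Lattice"
begin

text \<open>
  The limit ordinal is represented by a type of sort \<open>{wellorder, no_top}\<close>: a nonempty well-order
  without a greatest element, whose elements are the ordinals below the limit ordinal.
\<close>

record ('a, 'i) strat = "'a gorder" +
  sle :: "'i \<Rightarrow> 'a \<Rightarrow> 'a \<Rightarrow> bool"

definition seq :: "('a, 'i, 'm) strat_scheme \<Rightarrow> 'i \<Rightarrow> 'a \<Rightarrow> 'a \<Rightarrow> bool" where
  "seq L \<alpha> x y \<longleftrightarrow> sle L \<alpha> x y \<and> sle L \<alpha> y x"

locale stratified_complete_lattice = complete_lattice L
  for L :: "('a, 'i::{wellorder, no_top}, 'm) strat_scheme" (structure) +
  assumes sle_refl: "x \<in> carrier L \<Longrightarrow> sle L \<alpha> x x"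
    and sle_trans: "\<lbrakk>x \<in> carrier L; y \<in> carrier L; z \<in> carrier L; sle L \<alpha> x y; sle L \<alpha> y z\<rbrakk>
      \<Longrightarrow> sle L \<alpha> x z"

definition is_trunc :: "('a, 'i, 'm) strat_scheme \<Rightarrow> 'i \<Rightarrow> 'a \<Rightarrow> 'a \<Rightarrow> bool" where
  "is_trunc L \<alpha> x y \<longleftrightarrow>
    y \<in> carrier L \<and> seq L \<alpha> x y \<and> (\<forall>z\<in>carrier L. sle L \<alpha> x z \<longrightarrow> y \<sqsubseteq>\<^bsub>L\<^esub> z)"

text \<open>The element \<open>x|\<^sub>\<alpha>\<close>; see \<open>is_trunc_trunc\<close> below for existence and uniqueness in a model.\<close>

definition trunc :: "('a, 'i, 'm) strat_scheme \<Rightarrow> 'i \<Rightarrow> 'a \<Rightarrow> 'a" where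
  "trunc L \<alpha> x = (THE y. is_trunc L \<alpha> x y)"

locale strat_model = stratified_complete_lattice L
  for L :: "('a, 'i::{wellorder, no_top}, 'm) strat_scheme" (structure) +
  assumes A1: "\<lbrakk>\<alpha> < \<beta>; x \<in> carrier L; y \<in> carrier L; sle L \<beta> x y\<rbrakk> \<Longrightarrow> seq L \<alpha> x y"
    and A2: "\<lbrakk>x \<in> carrier L; y \<in> carrier L; \<And>\<alpha>. seq L \<alpha> x y\<rbrakk> \<Longrightarrow> x = y"
    and A3: "x \<in> carrier L \<Longrightarrow> \<exists>y. is_trunc L \<alpha> x y"
    and A4: "\<lbrakk>X \<subseteq> carrier L; X \<noteq> {}; y \<in> carrier L; \<And>x. x \<in> X \<Longrightarrow> seq L \<alpha> x y\<rbrakk>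
      \<Longrightarrow> seq L \<alpha> (\<Squnion>X) y"
    and A5: "\<lbrakk>x \<in> carrier L; y \<in> carrier L; x \<sqsubseteq> y\<rbrakk> \<Longrightarrow> trunc L \<alpha> x \<sqsubseteq> trunc L \<alpha> y"
    and A6: "\<lbrakk>x \<in> carrier L; y \<in> carrier L; x \<sqsubseteq> y; \<And>\<beta>. \<beta> < \<alpha> \<Longrightarrow> seq L \<beta> x y\<rbrakk>
      \<Longrightarrow> sle L \<alpha> x y"
begin

lemma is_trunc_trunc:
  assumes "x \<in> carrier L"
  shows "is_trunc L \<alpha> x (trunc L \<alpha> x)"
proof -
  obtain y where y: "is_trunc L \<alpha> x y"
    using A3[OF assms] by blast
  have "z = y" if "is_trunc L \<alpha> x z" for z
    using that y by (auto simp: is_trunc_def seq_def intro: le_antisym)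
  with y show ?thesis
    unfolding trunc_def by (rule theI)
qed

end

definition strat_iso ::
    "('a, 'i::{wellorder, no_top}, 'm) strat_scheme \<Rightarrow> ('b, 'i, 'n) strat_scheme \<Rightarrow> ('a \<Rightarrow> 'b) \<Rightarrow> bool"
  where
  "strat_iso L M f \<longleftrightarrow>
    stratified_complete_lattice L \<and> stratified_complete_lattice M \<and>
    bij_betw f (carrier L) (carrier M) \<and>
    (\<forall>x\<in>carrier L. \<forall>y\<in>carrier L.
      (x \<sqsubseteq>\<^bsub>L\<^esub> y \<longleftrightarrow> f x \<sqsubseteq>\<^bsub>M\<^esub> f y) \<and> (\<forall>\<alpha>. sle L \<alpha> x y \<longleftrightarrow> sle M \<alpha> (f x) (f y)))"

definition projection ::
    "('b, 'n) gorder_scheme \<Rightarrow> ('a, 'm) gorder_scheme \<Rightarrow> ('b \<Rightarrow> 'a) \<Rightarrow> bool" where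
  "projection L' L h \<longleftrightarrow>
    h \<in> carrier L' \<rightarrow> carrier L \<and> isotone L' L h \<and>
    (\<exists>k. k \<in> carrier L \<rightarrow> carrier L' \<and> isotone L L' k \<and>
      (\<forall>x\<in>carrier L. h (k x) = x) \<and> (\<forall>y\<in>carrier L'. k (h y) \<sqsubseteq>\<^bsub>L'\<^esub> y))"

definition locally_completely_additive ::
    "('b, 'n) gorder_scheme \<Rightarrow> ('a, 'm) gorder_scheme \<Rightarrow> ('b \<Rightarrow> 'a) \<Rightarrow> bool" where
  "locally_completely_additive L' L h \<longleftrightarrow>
    (\<forall>Y x. Y \<subseteq> carrier L' \<longrightarrow> Y \<noteq> {} \<longrightarrow> x \<in> carrier L \<longrightarrow> (\<forall>y\<in>Y. h y = x) \<longrightarrow>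
      h (\<Squnion>\<^bsub>L'\<^esub> Y) = x)"

text \<open>\<open>h \<alpha> \<beta>\<close> is the map from \<open>A \<alpha>\<close> to \<open>A \<beta>\<close>; it is relevant only for \<open>\<beta> < \<alpha>\<close>.\<close>

definition inverse_system ::
    "('i::{wellorder, no_top} \<Rightarrow> 'a gorder) \<Rightarrow> ('i \<Rightarrow> 'i \<Rightarrow> 'a \<Rightarrow> 'a) \<Rightarrow> bool" where
  "inverse_system A h \<longleftrightarrow>
    (\<forall>\<alpha>. complete_lattice (A \<alpha>)) \<and>
    (\<forall>\<alpha> \<beta>. \<beta> < \<alpha> \<longrightarrow> projection (A \<alpha>) (A \<beta>) (h \<alpha> \<beta>)) \<and>
    (\<forall>\<alpha> \<beta> \<gamma>. \<gamma> < \<beta> \<longrightarrow> \<beta> < \<alpha> \<longrightarrow> (\<forall>x\<in>carrier (A \<alpha>). h \<beta> \<gamma> (h \<alpha> \<beta> x) = h \<alpha> \<gamma> x))"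

definition limit_strat ::
    "('i::{wellorder, no_top} \<Rightarrow> 'a gorder) \<Rightarrow> ('i \<Rightarrow> 'i \<Rightarrow> 'a \<Rightarrow> 'a) \<Rightarrow> ('i \<Rightarrow> 'a, 'i) strat" where
  "limit_strat A h =
    \<lparr>carrier = {x. (\<forall>\<alpha>. x \<alpha> \<in> carrier (A \<alpha>)) \<and> (\<forall>\<alpha> \<beta>. \<beta> < \<alpha> \<longrightarrow> h \<alpha> \<beta> (x \<alpha>) = x \<beta>)},
     eq = (=),
     le = (\<lambda>x y. \<forall>\<alpha>. x \<alpha> \<sqsubseteq>\<^bsub>A \<alpha>\<^esub> y \<alpha>),
     sle = (\<lambda>\<alpha> x y. x \<alpha> \<sqsubseteq>\<^bsub>A \<alpha>\<^esub> y \<alpha> \<and> (\<forall>\<beta><\<alpha>. x \<beta> = y \<beta>))\<rparr>"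

definition level :: "('a, 'i, 'm) strat_scheme \<Rightarrow> 'i \<Rightarrow> 'a gorder" where
  "level L \<alpha> = \<lparr>carrier = trunc L \<alpha> ` carrier L, eq = (=), le = le L\<rparr>"

definition level_map :: "('a, 'i, 'm) strat_scheme \<Rightarrow> 'i \<Rightarrow> 'i \<Rightarrow> 'a \<Rightarrow> 'a" where
  "level_map L \<alpha> \<beta> x = trunc L \<beta> x"

end

theory Submission
  imports Defs
begin

text \<open>
  Truncation \<open>x \<mapsto> x|\<^sub>\<alpha>\<close> is a monotone, deflationary, idempotent operator, so \<open>L|\<^sub>\<alpha>\<close>, its set of fixed
  points, is closed under suprema in \<open>L\<close>, and for \<open>\<beta> < \<alpha>\<close> the inclusion \<open>L|\<^sub>\<beta> \<subseteq> L|\<^sub>\<alpha>\<close> exhibits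
  \<open>x \<mapsto> x|\<^sub>\<beta>\<close> as a projection. If \<open>x\<close> is the supremum of a sequence \<open>(x\<^sub>\<alpha>)\<close> with \<open>x\<^sub>\<alpha>|\<^sub>\<beta> = x\<^sub>\<beta>\<close>, then the
  sequence is increasing, so \<open>x\<close> is already the supremum of the \<open>x\<^sub>\<beta>\<close> with \<open>\<beta> \<ge> \<alpha>\<close>; all of these are
  \<open>=\<^sub>\<alpha> x\<^sub>\<alpha>\<close>, and A4 gives \<open>x|\<^sub>\<alpha> = x\<^sub>\<alpha>\<close>. Hence \<open>x \<mapsto> (x|\<^sub>\<alpha>)\<^sub>\<alpha>\<close> maps onto the limit, and applied to the
  sequence of truncations of \<open>x\<close> the same argument shows that \<open>x\<close> is the supremum of its truncations,
  so that the map reflects the order. The relations \<open>\<sqsubseteq>\<^sub>\<alpha>\<close> are recovered from truncations by A6.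
\<close>

text \<open>Serves to carry completeness over to the limit. Every element of \<open>M\<close> is
  some \<open>f u\<close>, so bounds of an image set are images of bounds. The record field
  \<open>eq\<close> is pinned to equality, so that antisymmetry in \<open>M\<close> comes from that
  in \<open>L\<close>.\<close>

lemma complete_lattice_bij_transfer:
  fixes L :: "('a, 'm) gorder_scheme" and M :: "('b, 'n) gorder_scheme"
  assumes L: "complete_lattice L"
    and bij: "bij_betw f (carrier L) (carrier M)"
    and le: "\<And>x y. \<lbrakk>x \<in> carrier L; y \<in> carrier L\<rbrakk> \<Longrightarrow> x \<sqsubseteq>\<^bsub>L\<^esub> y \<longleftrightarrow> f x \<sqsubseteq>\<^bsub>M\<^esub> f y"
    and eq: "eq M = (=)"
  shows "complete_lattice M"
proof -
  interpret L: complete_lattice L by (rule L)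
  have M: "carrier M = f ` carrier L"
    using bij by (simp add: bij_betw_def)
  interpret M: partial_order M
  proof
    fix x y z
    show "x \<in> carrier M \<Longrightarrow> x \<sqsubseteq>\<^bsub>M\<^esub> x"
      using le unfolding M by auto
    show "x .=\<^bsub>M\<^esub> y" if "x \<sqsubseteq>\<^bsub>M\<^esub> y" "y \<sqsubseteq>\<^bsub>M\<^esub> x" "x \<in> carrier M" "y \<in> carrier M"
      using that unfolding M eq by (auto simp: le[symmetric] dest: L.le_antisym)
    show "x \<sqsubseteq>\<^bsub>M\<^esub> z"
      if "x \<sqsubseteq>\<^bsub>M\<^esub> y" "y \<sqsubseteq>\<^bsub>M\<^esub> z" "x \<in> carrier M" "y \<in> carrier M" "z \<in> carrier M"
      using that L.le_trans unfolding M by (auto simp: le[symmetric])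
  qed (simp_all add: eq)
  show ?thesis
  proof (rule M.complete_latticeI)
    fix A assume "A \<subseteq> carrier M"
    then obtain B where B: "B \<subseteq> carrier L" "A = f ` B"
      unfolding M by (auto simp: subset_image_iff)
    have "least M (f (\<Squnion>\<^bsub>L\<^esub>B)) (Upper M A)"
    proof (rule least_UpperI)
      show "x \<sqsubseteq>\<^bsub>M\<^esub> f (\<Squnion>\<^bsub>L\<^esub>B)" if "x \<in> A" for x
        using that B by (auto simp: le[symmetric] subsetD intro: L.weak.sup_upper)
      show "f (\<Squnion>\<^bsub>L\<^esub>B) \<sqsubseteq>\<^bsub>M\<^esub> y" if "y \<in> Upper M A" for y
      proof -
        obtain u where u: "u \<in> carrier L" "y = f u"
          using \<open>y \<in> Upper M A\<close> unfolding Upper_def M by auto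
        have "b \<sqsubseteq>\<^bsub>L\<^esub> u" if "b \<in> B" for b
          using \<open>y \<in> Upper M A\<close> that B u le[of b u] unfolding Upper_def M by auto
        then show ?thesis
          using B u by (simp add: le[symmetric] L.weak.sup_least)
      qed
    qed (use B M in auto)
    then show "\<exists>s. least M s (Upper M A)" ..
    have "greatest M (f (\<Sqinter>\<^bsub>L\<^esub>B)) (Lower M A)"
    proof (rule greatest_LowerI)
      show "f (\<Sqinter>\<^bsub>L\<^esub>B) \<sqsubseteq>\<^bsub>M\<^esub> x" if "x \<in> A" for x
        using that B by (auto simp: le[symmetric] subsetD intro: L.weak.inf_lower)
      show "y \<sqsubseteq>\<^bsub>M\<^esub> f (\<Sqinter>\<^bsub>L\<^esub>B)" if "y \<in> Lower M A" for y
      proof -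
        obtain u where u: "u \<in> carrier L" "y = f u"
          using \<open>y \<in> Lower M A\<close> unfolding Lower_def M by auto
        have "u \<sqsubseteq>\<^bsub>L\<^esub> b" if "b \<in> B" for b
          using \<open>y \<in> Lower M A\<close> that B u le[of u b] unfolding Lower_def M by auto
        then show ?thesis
          using B u by (simp add: le[symmetric] L.weak.inf_greatest)
      qed
    qed (use B M in auto)
    then show "\<exists>i. greatest M i (Lower M A)" ..
  qed
qed

section \<open>Truncation and the preorders\<close>

context strat_model
begin

lemma trunc_closed [simp]: "x \<in> carrier L \<Longrightarrow> trunc L \<alpha> x \<in> carrier L"
  using is_trunc_trunc by (auto simp: is_trunc_def)

lemma seq_trunc: "x \<in> carrier L \<Longrightarrow> seq L \<alpha> x (trunc L \<alpha> x)"
  using is_trunc_trunc by (auto simp: is_trunc_def)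

lemma trunc_least:
  "\<lbrakk>x \<in> carrier L; z \<in> carrier L; sle L \<alpha> x z\<rbrakk> \<Longrightarrow> trunc L \<alpha> x \<sqsubseteq> z"
  using is_trunc_trunc by (auto simp: is_trunc_def)

lemma trunc_le: "x \<in> carrier L \<Longrightarrow> trunc L \<alpha> x \<sqsubseteq> x"
  by (simp add: trunc_least sle_refl)

lemma seq_sym: "seq L \<alpha> x y \<Longrightarrow> seq L \<alpha> y x"
  by (simp add: seq_def)

lemma seq_trans:
  "\<lbrakk>seq L \<alpha> x y; seq L \<alpha> y z; x \<in> carrier L; y \<in> carrier L; z \<in> carrier L\<rbrakk> \<Longrightarrow> seq L \<alpha> x z"
  unfolding seq_def by (blast intro: sle_trans)

lemma seq_mono:
  assumes "seq L \<beta> x y" "\<alpha> \<le> \<beta>" "x \<in> carrier L" "y \<in> carrier L"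
  shows "seq L \<alpha> x y"
  using assms A1[of \<alpha> \<beta> x y] by (cases "\<alpha> = \<beta>") (auto simp: seq_def)

text \<open>As \<open>y\<close> and \<open>trunc L \<alpha> y\<close> are \<alpha>-equivalent, the
  latter is among the elements that \<open>trunc L \<alpha> x\<close> lies below by
  minimality.\<close>

lemma trunc_mono_sle:
  assumes "sle L \<alpha> x y" "x \<in> carrier L" "y \<in> carrier L"
  shows "trunc L \<alpha> x \<sqsubseteq> trunc L \<alpha> y"
proof -
  have "sle L \<alpha> x (trunc L \<alpha> y)"
    using assms seq_trunc[of y \<alpha>] unfolding seq_def by (blast intro: sle_trans trunc_closed)
  then show ?thesis
    using assms by (simp add: trunc_least)
qed

text \<open>Turns equivalences into equations between truncations, the form in which later arguments
  use them.\<close>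

lemma seq_iff_trunc_eq:
  assumes "x \<in> carrier L" "y \<in> carrier L"
  shows "seq L \<alpha> x y \<longleftrightarrow> trunc L \<alpha> x = trunc L \<alpha> y"
proof
  assume "seq L \<alpha> x y"
  then show "trunc L \<alpha> x = trunc L \<alpha> y"
    using assms by (intro le_antisym) (auto simp: seq_def trunc_mono_sle)
next
  assume "trunc L \<alpha> x = trunc L \<alpha> y"
  then show "seq L \<alpha> x y"
    using assms seq_trunc[of x \<alpha>] seq_trunc[of y \<alpha>] by (metis seq_sym seq_trans trunc_closed)
qed

lemma trunc_trunc_lower:
  assumes "x \<in> carrier L" "\<beta> \<le> \<alpha>"
  shows "trunc L \<beta> (trunc L \<alpha> x) = trunc L \<beta> x"
  using assms seq_mono[OF seq_trunc[of x \<alpha>], of \<beta>] by (simp add: seq_iff_trunc_eq)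

text \<open>Truncating at the larger \<beta> keeps the \<alpha>-class of \<open>x\<close>, and
  \<open>trunc L \<alpha> x\<close> is already least in the order there. Consequently the levels
  grow with the index.\<close>

lemma trunc_trunc_upper:
  assumes "x \<in> carrier L" "\<alpha> \<le> \<beta>"
  shows "trunc L \<beta> (trunc L \<alpha> x) = trunc L \<alpha> x"
proof (rule le_antisym)
  let ?y = "trunc L \<beta> (trunc L \<alpha> x)"
  have "seq L \<alpha> (trunc L \<alpha> x) ?y"
    using assms seq_mono[OF seq_trunc] by simp
  then have "seq L \<alpha> x ?y"
    using assms seq_trunc[of x \<alpha>] by (blast intro: seq_trans trunc_closed)
  then show "trunc L \<alpha> x \<sqsubseteq> ?y"
    using assms by (simp add: trunc_least seq_def)
qed (use assms in \<open>simp_all add: trunc_le\<close>)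

lemma sle_iff_trunc:
  assumes x: "x \<in> carrier L" and y: "y \<in> carrier L"
  shows "sle L \<alpha> x y \<longleftrightarrow> trunc L \<alpha> x \<sqsubseteq> trunc L \<alpha> y \<and> (\<forall>\<beta><\<alpha>. trunc L \<beta> x = trunc L \<beta> y)"
proof
  assume "sle L \<alpha> x y"
  then show "trunc L \<alpha> x \<sqsubseteq> trunc L \<alpha> y \<and> (\<forall>\<beta><\<alpha>. trunc L \<beta> x = trunc L \<beta> y)"
    using x y A1 by (auto simp: trunc_mono_sle seq_iff_trunc_eq[symmetric])
next
  assume "trunc L \<alpha> x \<sqsubseteq> trunc L \<alpha> y \<and> (\<forall>\<beta><\<alpha>. trunc L \<beta> x = trunc L \<beta> y)"
  \<comment> \<open>\<open>x\<close> and \<open>y\<close> need not be comparable in the order, but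
    their truncations are; A6 is applied to these and the result is carried back along
    \<alpha>-equivalence.\<close>
  then have "sle L \<alpha> (trunc L \<alpha> x) (trunc L \<alpha> y)"
    using x y by (intro A6) (auto simp: seq_iff_trunc_eq trunc_trunc_lower)
  with seq_trunc[OF x, of \<alpha>] seq_trunc[OF y, of \<alpha>] show "sle L \<alpha> x y"
    unfolding seq_def using x y by (blast intro: sle_trans trunc_closed)
qed

section \<open>The levels as complete lattices\<close>

lemma carrier_level_iff: "x \<in> carrier (level L \<alpha>) \<longleftrightarrow> x \<in> carrier L \<and> trunc L \<alpha> x = x"
  by (auto simp: level_def trunc_trunc_lower) (metis imageI)

lemma level_le [simp]: "le (level L \<alpha>) = le L"
  by (simp add: level_def)

lemma level_eq [simp]: "eq (level L \<alpha>) = (=)"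
  by (simp add: level_def)

lemma trunc_in_level [simp]: "x \<in> carrier L \<Longrightarrow> trunc L \<alpha> x \<in> carrier (level L \<alpha>)"
  by (simp add: level_def)

lemma level_closed: "x \<in> carrier (level L \<alpha>) \<Longrightarrow> x \<in> carrier L"
  by (simp add: carrier_level_iff)

text \<open>By A5 the truncation of the supremum still bounds the fixed points in \<open>Y\<close>,
  so the supremum lies below its own truncation.\<close>

lemma sup_in_level:
  assumes "Y \<subseteq> carrier (level L \<alpha>)"
  shows "\<Squnion>Y \<in> carrier (level L \<alpha>)"
proof -
  have Y: "Y \<subseteq> carrier L"
    using assms level_closed by blast
  have "y \<sqsubseteq> trunc L \<alpha> (\<Squnion>Y)" if "y \<in> Y" for y
    using A5[of y "\<Squnion>Y" \<alpha>] that assms Y weak.sup_upper[OF Y that]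
    by (auto simp: carrier_level_iff subset_iff)
  then have "\<Squnion>Y \<sqsubseteq> trunc L \<alpha> (\<Squnion>Y)"
    using Y by (simp add: weak.sup_least)
  then show ?thesis
    using Y by (auto simp: carrier_level_iff intro!: le_antisym trunc_le)
qed

lemma partial_order_level: "partial_order (level L \<alpha>)"
proof
  fix x y z
  show "x \<sqsubseteq>\<^bsub>level L \<alpha>\<^esub> z"
    if "x \<sqsubseteq>\<^bsub>level L \<alpha>\<^esub> y" "y \<sqsubseteq>\<^bsub>level L \<alpha>\<^esub> z" "x \<in> carrier (level L \<alpha>)"
      "y \<in> carrier (level L \<alpha>)" "z \<in> carrier (level L \<alpha>)"
    using that by (auto intro: le_trans dest!: level_closed)
qed (auto dest: level_closed intro: le_antisym)

lemma least_level_sup: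
  assumes "Y \<subseteq> carrier (level L \<alpha>)"
  shows "least (level L \<alpha>) (\<Squnion>Y) (Upper (level L \<alpha>) Y)"
proof -
  have Y: "Y \<subseteq> carrier L"
    using assms level_closed by blast
  show ?thesis
  proof (rule least_UpperI)
    show "\<Squnion>Y \<sqsubseteq>\<^bsub>level L \<alpha>\<^esub> y" if "y \<in> Upper (level L \<alpha>) Y" for y
      using that Y assms by (auto simp: Upper_def dest: level_closed intro!: weak.sup_least)
  qed (use assms Y in \<open>simp_all add: weak.sup_upper sup_in_level\<close>)
qed

text \<open>Truncation brings the infimum of \<open>L\<close> into the level; by A5 it stays above
  every lower bound that is itself fixed.\<close>

lemma greatest_level_inf:
  assumes "Y \<subseteq> carrier (level L \<alpha>)"
  shows "greatest (level L \<alpha>) (trunc L \<alpha> (\<Sqinter>Y)) (Lower (level L \<alpha>) Y)"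
proof -
  have Y: "Y \<subseteq> carrier L"
    using assms level_closed by blast
  show ?thesis
  proof (rule greatest_LowerI)
    show "trunc L \<alpha> (\<Sqinter>Y) \<sqsubseteq>\<^bsub>level L \<alpha>\<^esub> y" if "y \<in> Y" for y
      using that Y le_trans[OF trunc_le weak.inf_lower[OF Y that]] by auto
    show "y \<sqsubseteq>\<^bsub>level L \<alpha>\<^esub> trunc L \<alpha> (\<Sqinter>Y)" if y: "y \<in> Lower (level L \<alpha>) Y" for y
    proof -
      have "y \<in> carrier L" "trunc L \<alpha> y = y"
        using y by (auto simp: Lower_def carrier_level_iff)
      moreover have "y \<sqsubseteq> \<Sqinter>Y"
        using y assms Y by (auto simp: Lower_def dest: level_closed intro!: weak.inf_greatest)
      ultimately show ?thesis
        using A5[of y "\<Sqinter>Y" \<alpha>] Y by simp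
    qed
  qed (use assms Y in simp_all)
qed

lemma complete_lattice_level: "complete_lattice (level L \<alpha>)"
  by (rule partial_order.complete_latticeI[OF partial_order_level])
    (blast intro: least_level_sup greatest_level_inf)+

text \<open>\<open>sup\<close> chooses some least upper bound, and antisymmetry makes it unique.
  This lets A4, which speaks of suprema in \<open>L\<close>, act inside a level.\<close>

lemma sup_level:
  "Y \<subseteq> carrier (level L \<alpha>) \<Longrightarrow> \<Squnion>\<^bsub>level L \<alpha>\<^esub>Y = \<Squnion>Y"
  unfolding sup_def[of "level L \<alpha>"]
  by (rule some_equality) (blast intro: least_level_sup partial_order.least_unique[OF partial_order_level])+

section \<open>The connecting maps\<close>

lemma projection_level:
  assumes "\<beta> \<le> \<alpha>"
  shows "projection (level L \<alpha>) (level L \<beta>) (level_map L \<alpha> \<beta>)"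
proof -
  \<comment> \<open>\<open>isotone\<close> includes that both structures are weak partial
    orders.\<close>
  have wpo: "weak_partial_order (level L \<gamma>)" for \<gamma>
    using partial_order_level by (rule partial_order.axioms)
  \<comment> \<open>The section \<open>k\<close> is the inclusion of levels.\<close>
  have "(\<lambda>x. x) \<in> carrier (level L \<beta>) \<rightarrow> carrier (level L \<alpha>)"
    using assms by (auto simp: carrier_level_iff) (metis trunc_trunc_upper)
  then show ?thesis
    unfolding projection_def isotone_def
    using wpo
    by (auto simp: level_map_def trunc_le dest: level_closed intro!: exI[of _ "\<lambda>x. x"])
      (simp_all add: carrier_level_iff A5)
qed

text \<open>A fibre of truncation consists of \<beta>-equivalent elements, and A4 keeps nonempty
  suprema in their class.\<close>

lemma locally_completely_additive_level:
  "locally_completely_additive (level L \<alpha>) (level L \<beta>) (level_map L \<alpha> \<beta>)"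
  unfolding locally_completely_additive_def level_map_def
proof (intro allI impI)
  fix Y x
  assume Y: "Y \<subseteq> carrier (level L \<alpha>)" "Y \<noteq> {}" and x: "x \<in> carrier (level L \<beta>)"
    and eq: "\<forall>y\<in>Y. trunc L \<beta> y = x"
  have YL: "Y \<subseteq> carrier L" and xL: "x \<in> carrier L" "trunc L \<beta> x = x"
    using Y x by (auto simp: carrier_level_iff)
  have "seq L \<beta> (\<Squnion>Y) x"
    using Y YL xL eq by (intro A4) (auto simp: seq_iff_trunc_eq subset_iff)
  then show "trunc L \<beta> (\<Squnion>\<^bsub>level L \<alpha>\<^esub>Y) = x"
    using Y YL xL by (simp add: seq_iff_trunc_eq sup_level)
qed

lemma inverse_system_level: "inverse_system (level L) (level_map L)"
  unfolding inverse_system_def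
  by (auto simp: complete_lattice_level projection_level level_map_def trunc_trunc_lower
      dest: level_closed)

section \<open>Suprema of compatible sequences\<close>

lemma trunc_sup_compatible:
  assumes s: "\<And>\<alpha>. s \<alpha> \<in> carrier (level L \<alpha>)"
    and compat: "\<And>\<alpha> \<beta>. \<beta> < \<alpha> \<Longrightarrow> trunc L \<beta> (s \<alpha>) = s \<beta>"
  shows "trunc L \<alpha> (\<Squnion>(range s)) = s \<alpha>"
proof -
  have sL: "s \<gamma> \<in> carrier L" "trunc L \<gamma> (s \<gamma>) = s \<gamma>" for \<gamma>
    using s[of \<gamma>] by (auto simp: carrier_level_iff)
  have trunc_s: "trunc L \<beta> (s \<gamma>) = s \<beta>" if "\<beta> \<le> \<gamma>" for \<beta> \<gamma>
    using that compat[of \<beta> \<gamma>] sL by (cases "\<beta> = \<gamma>") auto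
  then have mono: "s \<beta> \<sqsubseteq> s \<gamma>" if "\<beta> \<le> \<gamma>" for \<beta> \<gamma>
    using trunc_le[OF sL(1), of \<beta> \<gamma>] that by simp
  have sub: "range s \<subseteq> carrier L" "s ` {\<alpha>..} \<subseteq> carrier L"
    using sL by auto
  have tail: "\<Squnion>(range s) = \<Squnion>(s ` {\<alpha>..})"
  proof (rule le_antisym)
    \<comment> \<open>The index \<open>max \<alpha> \<beta>\<close> lies in the tail even when
      \<beta> does not.\<close>
    have "s \<beta> \<sqsubseteq> \<Squnion>(s ` {\<alpha>..})" for \<beta>
      using mono[of \<beta> "max \<alpha> \<beta>"] weak.sup_upper[OF sub(2), of "s (max \<alpha> \<beta>)"] sub sL
      by (auto intro: le_trans)
    then show "\<Squnion>(range s) \<sqsubseteq> \<Squnion>(s ` {\<alpha>..})"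
      using sub by (intro weak.sup_least) auto
    show "\<Squnion>(s ` {\<alpha>..}) \<sqsubseteq> \<Squnion>(range s)"
      using sub by (intro weak.sup_least) (auto intro: weak.sup_upper)
  qed (use sub in simp_all)
  \<comment> \<open>The tail contains the index \<alpha>, so the set is nonempty as A4
    demands.\<close>
  have "seq L \<alpha> (\<Squnion>(s ` {\<alpha>..})) (s \<alpha>)"
    using sub sL trunc_s by (intro A4) (auto simp: seq_iff_trunc_eq)
  then show ?thesis
    using sub sL unfolding tail by (simp add: seq_iff_trunc_eq)
qed

lemma eq_if_trunc_eq:
  assumes "x \<in> carrier L" "y \<in> carrier L" "\<And>\<alpha>. trunc L \<alpha> x = trunc L \<alpha> y"
  shows "x = y"
  using assms by (intro A2) (auto simp: seq_iff_trunc_eq)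

lemma sup_truncs:
  assumes "x \<in> carrier L"
  shows "\<Squnion>(range (\<lambda>\<alpha>. trunc L \<alpha> x)) = x"
proof (rule eq_if_trunc_eq)
  show "trunc L \<alpha> (\<Squnion>(range (\<lambda>\<alpha>. trunc L \<alpha> x))) = trunc L \<alpha> x" for \<alpha>
    using assms by (intro trunc_sup_compatible) (auto simp: trunc_trunc_lower)
  show "\<Squnion>(range (\<lambda>\<alpha>. trunc L \<alpha> x)) \<in> carrier L"
    using assms by (intro weak.sup_closed) auto
qed (rule assms)

lemma le_iff_trunc:
  assumes x: "x \<in> carrier L" and y: "y \<in> carrier L"
  shows "x \<sqsubseteq> y \<longleftrightarrow> (\<forall>\<alpha>. trunc L \<alpha> x \<sqsubseteq> trunc L \<alpha> y)"
proof
  assume "\<forall>\<alpha>. trunc L \<alpha> x \<sqsubseteq> trunc L \<alpha> y"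
  then have "trunc L \<alpha> x \<sqsubseteq> y" for \<alpha>
    using x y by (blast intro: le_trans trunc_le trunc_closed)
  then have "\<Squnion>(range (\<lambda>\<alpha>. trunc L \<alpha> x)) \<sqsubseteq> y"
    using x y by (intro weak.sup_least) auto
  then show "x \<sqsubseteq> y"
    by (simp only: sup_truncs[OF x])
qed (use x y A5 in blast)

section \<open>The isomorphism with the limit\<close>

lemma bij_betw_truncs:
  "bij_betw (\<lambda>x \<alpha>. trunc L \<alpha> x) (carrier L) (carrier (limit_strat (level L) (level_map L)))"
proof (rule bij_betw_imageI)
  show "inj_on (\<lambda>x \<alpha>. trunc L \<alpha> x) (carrier L)"
    by (rule inj_onI) (metis eq_if_trunc_eq)
  have "s \<in> (\<lambda>x \<alpha>. trunc L \<alpha> x) ` carrier L"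
    if "\<And>\<alpha>. s \<alpha> \<in> carrier (level L \<alpha>)" "\<And>\<alpha> \<beta>. \<beta> < \<alpha> \<Longrightarrow> trunc L \<beta> (s \<alpha>) = s \<beta>" for s
  proof
    show "s = (\<lambda>\<alpha>. trunc L \<alpha> (\<Squnion>(range s)))"
      using trunc_sup_compatible[OF that] by simp
    show "\<Squnion>(range s) \<in> carrier L"
      using that(1) level_closed by (blast intro: weak.sup_closed)
  qed
  then show "(\<lambda>x \<alpha>. trunc L \<alpha> x) ` carrier L = carrier (limit_strat (level L) (level_map L))"
    by (auto simp: limit_strat_def level_map_def trunc_trunc_lower)
qed

lemma strat_iso_truncs:
  "strat_iso L (limit_strat (level L) (level_map L)) (\<lambda>x \<alpha>. trunc L \<alpha> x)"
proof -
  let ?M = "limit_strat (level L) (level_map L)" and ?f = "\<lambda>x \<alpha>. trunc L \<alpha> x"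
  have le: "x \<sqsubseteq> y \<longleftrightarrow> ?f x \<sqsubseteq>\<^bsub>?M\<^esub> ?f y" if "x \<in> carrier L" "y \<in> carrier L" for x y
    using le_iff_trunc[OF that] by (simp add: limit_strat_def)
  have sle: "sle L \<alpha> x y \<longleftrightarrow> sle ?M \<alpha> (?f x) (?f y)" if "x \<in> carrier L" "y \<in> carrier L" for x y \<alpha>
    using sle_iff_trunc[OF that] by (simp add: limit_strat_def)
  have M: "carrier ?M = ?f ` carrier L"
    using bij_betw_truncs by (simp add: bij_betw_def)
  \<comment> \<open>Transport from \<open>L\<close> avoids computing bounds of sets of compatible
    sequences.\<close>
  have "complete_lattice ?M"
    by (rule complete_lattice_bij_transfer[OF complete_lattice_axioms bij_betw_truncs le])
      (simp_all add: limit_strat_def)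
  then have "stratified_complete_lattice ?M"
  proof (rule stratified_complete_lattice.intro)
    show "stratified_complete_lattice_axioms ?M"
    proof
      fix \<alpha> x y z
      show "x \<in> carrier ?M \<Longrightarrow> sle ?M \<alpha> x x"
        unfolding M using sle sle_refl by auto
      show "sle ?M \<alpha> x z" if "x \<in> carrier ?M" "y \<in> carrier ?M" "z \<in> carrier ?M"
          "sle ?M \<alpha> x y" "sle ?M \<alpha> y z"
        using that unfolding M by (auto simp: sle[symmetric] intro: sle_trans)
    qed
  qed
  then show ?thesis
    unfolding strat_iso_def
    using stratified_complete_lattice_axioms bij_betw_truncs le sle by blast
qed

end

theorem theorem2:
  fixes L :: "('a, 'i::{wellorder, no_top}) strat"
  assumes "strat_model L"
  shows "(\<forall>\<alpha>. complete_lattice (level L \<alpha>)) \<and>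
    (\<forall>\<alpha> \<beta>. \<beta> < \<alpha> \<longrightarrow>
      projection (level L \<alpha>) (level L \<beta>) (level_map L \<alpha> \<beta>) \<and>
      locally_completely_additive (level L \<alpha>) (level L \<beta>) (level_map L \<alpha> \<beta>)) \<and>
    inverse_system (level L) (level_map L) \<and>
    (\<exists>f. strat_iso L (limit_strat (level L) (level_map L)) f)"
proof -
  interpret strat_model L by (rule assms)
  show ?thesis
    using complete_lattice_level projection_level[OF less_imp_le] locally_completely_additive_level
      inverse_system_level strat_iso_truncs
    by blast
qed

end
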